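(* Suppose a sample consists of $a\ge 1$ individuals, each belonging to exactly one of $s$ species. Let $m_x(a)$ denote the number of species having exactly $x$ individuals in the sample, and let $\bar{m}_j(h)$ denote the average, over all subsamples of size $h$ of the $a$ individuals, of the number of species having exactly $j$ individuals in the subsample. Then for all $h=1,2,\dots,a$ and $j=1,2,\dots,h$, $$\bar{m}_j(h)=\sum_{k=0}^{a-h}\binom{k+j}{j}\binom{a-k-j}{h-j}\binom{a}{h}^{-1}m_{k+j}(a).$$
   Context: A subsample of size $h$ is a subset of $h$ of the $a$ individuals (chosen without replacement, the individuals being distinguishable); there are $\binom{a}{h}$ such subsamples, and $\bar{m}_j(h)$ is the arithmetic mean over all of them (the "enumeration procedure"): if $\Omega$ is the set of all $h$-element subsets of $\{1,\dots,a\}$ and $Z_{ir}=1$ if individual $r$ belongs to species $i$ and $Z_{ir}=0$ otherwise, then $$\bar{m}_j(h)=\binom{a}{h}^{-1}\sum_{\omega\in\Omega}\#\Bigl\{i\in\{1,\dots,s\}:\sum_{r\in\omega}Z_{ir}=j\Bigr\},\qquad m_x(a)=\#\Bigl\{i\in\{1,\dots,s\}:\sum_{r=1}^{a}Z_{ir}=x\Bigr\}.$$ *)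

theory Defs
  imports Complex_Main
begin

text \<open>
  Individuals are \<open>1, \<dots>, a\<close> and species are \<open>1, \<dots>, s\<close>. A sample is given by a function
  \<open>sp\<close> sending each individual to its species, so that an individual belongs to exactly
  one species as soon as \<open>sp\<close> maps \<open>{1..a}\<close> into \<open>{1..s}\<close>.
\<close>

definition Z :: "(nat \<Rightarrow> nat) \<Rightarrow> nat \<Rightarrow> nat \<Rightarrow> nat" where
  "Z sp i r = (if sp r = i then 1 else 0)"

definition species_count :: "nat \<Rightarrow> (nat \<Rightarrow> nat) \<Rightarrow> nat set \<Rightarrow> nat \<Rightarrow> nat" where
  "species_count s sp A x = card {i \<in> {1..s}. (\<Sum>r\<in>A. Z sp i r) = x}"

definition subsamples :: "nat \<Rightarrow> nat \<Rightarrow> nat set set" where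
  "subsamples a h = {\<omega>. \<omega> \<subseteq> {1..a} \<and> card \<omega> = h}"

definition m :: "nat \<Rightarrow> (nat \<Rightarrow> nat) \<Rightarrow> nat \<Rightarrow> nat \<Rightarrow> nat" where
  "m s sp x a = species_count s sp {1..a} x"

definition m_bar :: "nat \<Rightarrow> (nat \<Rightarrow> nat) \<Rightarrow> nat \<Rightarrow> nat \<Rightarrow> nat \<Rightarrow> real" where
  "m_bar s sp a j h =
     inverse (real (a choose h)) * (\<Sum>\<omega>\<in>subsamples a h. real (species_count s sp \<omega> j))"

end

theory Submission
  imports Defs
begin

text \<open>
  Double counting: summing the species counts over all subsamples amounts to counting, for each
  species, the subsamples containing exactly \<open>j\<close> of its individuals. If the species has \<open>x\<close>
  individuals, there are \<open>(x choose j) * ((a - x) choose (h - j))\<close> of these. Grouping the species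
  by \<open>x = k + j\<close> gives the formula, since only \<open>j \<le> x \<le> a - h + j\<close> contributes.
\<close>

lemma sum_Z_eq_card:
  assumes "finite A"
  shows "(\<Sum>r\<in>A. Z sp i r) = card {r \<in> A. sp r = i}"
  using assms by (simp add: Z_def sum.If_cases Int_def)

text \<open>A set \<open>\<omega>\<close> is determined by its traces inside and outside
  \<open>S\<close>, and these can be chosen independently: \<open>j\<close> elements from
  \<open>S\<close> and \<open>h - j\<close> from \<open>U - S\<close>.\<close>

lemma card_subsets_inter:
  assumes "finite U" "S \<subseteq> U" "j \<le> h"
  shows "card {\<omega>. \<omega> \<subseteq> U \<and> card \<omega> = h \<and> card (\<omega> \<inter> S) = j}
    = (card S choose j) * ((card U - card S) choose (h - j))"
proof -
  let ?A = "{P. P \<subseteq> S \<and> card P = j}"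
  let ?B = "{Q. Q \<subseteq> U - S \<and> card Q = h - j}"
  have fin: "finite S" using assms finite_subset by blast
  have "bij_betw (\<lambda>\<omega>. (\<omega> \<inter> S, \<omega> - S)) {\<omega>. \<omega> \<subseteq> U \<and> card \<omega> = h \<and> card (\<omega> \<inter> S) = j} (?A \<times> ?B)"
  proof (rule bij_betw_byWitness[where f' = "\<lambda>(P, Q). P \<union> Q"], goal_cases)
    case 1
    then show ?case by auto
  next
    case 2
    then show ?case by auto
  next
    case 3
    \<comment> \<open>This puts the second component in \<open>?B\<close>: the part outside
      \<open>S\<close> has \<open>h - j\<close> elements.\<close>
    have "card (\<omega> - S) = card \<omega> - card (\<omega> \<inter> S)" for \<omega>
      using fin card_Diff_subset_Int[of \<omega> S] by simp
    then show ?case by auto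
  next
    case 4
    have "P \<union> Q \<subseteq> U \<and> card (P \<union> Q) = h \<and> card ((P \<union> Q) \<inter> S) = j"
      if "P \<in> ?A" "Q \<in> ?B" for P Q
    proof -
      have "finite P" "finite Q"
        using that fin assms(1) by (auto intro: finite_subset)
      moreover have "P \<inter> Q = {}" "(P \<union> Q) \<inter> S = P"
        using that by auto
      ultimately show ?thesis
        using that assms by (auto simp: card_Un_disjoint)
    qed
    then show ?case
      by (intro image_subsetI) (simp only: mem_Times_iff case_prod_beta mem_Collect_eq)
  qed
  then show ?thesis
    using assms fin
    by (simp add: bij_betw_same_card card_cartesian_product n_subsets card_Diff_subset)
qed

lemma card_subsamples_species:
  assumes "j \<le> h"
  shows "card {\<omega> \<in> subsamples a h. (\<Sum>r\<in>\<omega>. Z sp i r) = j}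
    = (card {r \<in> {1..a}. sp r = i} choose j) * ((a - card {r \<in> {1..a}. sp r = i}) choose (h - j))"
proof -
  let ?S = "{r \<in> {1..a}. sp r = i}"
  have "(\<Sum>r\<in>\<omega>. Z sp i r) = card (\<omega> \<inter> ?S)" if "\<omega> \<subseteq> {1..a}" for \<omega>
  proof -
    have "{r \<in> \<omega>. sp r = i} = \<omega> \<inter> ?S"
      using that by auto
    then show ?thesis
      using that sum_Z_eq_card finite_subset[OF that] by simp
  qed
  then have "{\<omega> \<in> subsamples a h. (\<Sum>r\<in>\<omega>. Z sp i r) = j}
      = {\<omega>. \<omega> \<subseteq> {1..a} \<and> card \<omega> = h \<and> card (\<omega> \<inter> ?S) = j}"
    by (auto simp: subsamples_def)
  moreover have "?S \<subseteq> {1..a}"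
    by auto
  ultimately show ?thesis
    using card_subsets_inter[of "{1..a}" ?S j h] assms by simp
qed

text \<open>Species are grouped by their number of individuals, which is at most \<open>a\<close>;
  \<open>f\<close> is constant on each group, and the group of size \<open>x\<close> has
  \<open>m s sp x a\<close> members.\<close>

lemma sum_species_by_size:
  fixes f :: "nat \<Rightarrow> nat"
  shows "(\<Sum>i = 1..s. f (card {r \<in> {1..a}. sp r = i})) = (\<Sum>x\<le>a. m s sp x a * f x)"
proof -
  let ?n = "\<lambda>i. card {r \<in> {1..a}. sp r = i}"
  have "?n i \<le> a" for i
    using card_mono[of "{1..a}" "{r \<in> {1..a}. sp r = i}"] by (simp add: subset_iff)
  then have "(\<Sum>i = 1..s. f (?n i)) = (\<Sum>x\<le>a. \<Sum>i | i \<in> {1..s} \<and> ?n i = x. f (?n i))"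
    by (intro sum.group[symmetric]) auto
  also have "\<dots> = (\<Sum>x\<le>a. m s sp x a * f x)"
    by (intro sum.cong) (auto simp: m_def species_count_def sum_Z_eq_card)
  finally show ?thesis .
qed

lemma sum_species_count_subsamples:
  assumes "h \<le> a" "j \<le> h"
  shows "(\<Sum>\<omega>\<in>subsamples a h. species_count s sp \<omega> j)
    = (\<Sum>k = 0..a - h. m s sp (k + j) a * (((k + j) choose j) * ((a - k - j) choose (h - j))))"
proof -
  let ?f = "\<lambda>x. (x choose j) * ((a - x) choose (h - j))"
  have "finite (subsamples a h)"
    by (simp add: subsamples_def)
  then have "(\<Sum>\<omega>\<in>subsamples a h. species_count s sp \<omega> j)
      = (\<Sum>i = 1..s. ?f (card {r \<in> {1..a}. sp r = i}))"
    \<comment> \<open>The pairs of a subsample and a species with exactly \<open>j\<close>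
      individuals in it are counted species by species instead.\<close>
    unfolding species_count_def
    by (intro sum_multicount_gen) (auto simp only: card_subsamples_species[OF assms(2)])
  also have "\<dots> = (\<Sum>x\<le>a. m s sp x a * ?f x)"
    by (rule sum_species_by_size)
  \<comment> \<open>Both bounds are written as sums with \<open>j\<close> so that the index shift
    \<open>x = k + j\<close> applies directly.\<close>
  also have "\<dots> = (\<Sum>x = 0 + j..(a - h) + j. m s sp x a * ?f x)"
  proof (rule sum.mono_neutral_right)
    show "\<forall>x \<in> {..a} - {0 + j..(a - h) + j}. m s sp x a * ?f x = 0"
    proof
      fix x assume "x \<in> {..a} - {0 + j..(a - h) + j}"
      \<comment> \<open>Below the range \<open>x choose j\<close> vanishes; above it too few
        individuals of other species remain, so the second binomial vanishes.\<close>
      then have "x < j \<or> a - x < h - j"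
        using assms by auto
      then show "m s sp x a * ?f x = 0"
        by (auto simp: binomial_eq_0)
    qed
  qed (use assms in auto)
  also have "\<dots> = (\<Sum>k = 0..a - h. m s sp (k + j) a * ?f (k + j))"
    by (rule sum.shift_bounds_cl_nat_ivl)
  finally show ?thesis
    by (simp add: add.commute)
qed

theorem proposition2:
  fixes a s :: nat and sp :: "nat \<Rightarrow> nat"
  assumes "a \<ge> 1"
    and "\<forall>r\<in>{1..a}. sp r \<in> {1..s}"
  shows "\<forall>h\<in>{1..a}. \<forall>j\<in>{1..h}.
    m_bar s sp a j h =
      (\<Sum>k=0..a - h. real ((k + j) choose j) * real ((a - k - j) choose (h - j))
          * inverse (real (a choose h)) * real (m s sp (k + j) a))"
proof (intro ballI)
  fix h j assume "h \<in> {1..a}" "j \<in> {1..h}"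
  then have "h \<le> a" "j \<le> h"
    by auto
  \<comment> \<open>The count is an identity of naturals; only after the cast to reals is it divided
    by the number of subsamples.\<close>
  from sum_species_count_subsamples[OF this, of s sp, THEN arg_cong[where f = real]]
  show "m_bar s sp a j h =
      (\<Sum>k=0..a - h. real ((k + j) choose j) * real ((a - k - j) choose (h - j))
          * inverse (real (a choose h)) * real (m s sp (k + j) a))"
    by (simp add: m_bar_def sum_distrib_left mult_ac)
qed

end
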